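(* Let $W\ge 4$ be an integer, let $\phi_1,\phi_2\in\mathbb{R}$ with $\phi_2\neq 0$, and let $\mathbf{W}=(w_{i,j})_{i,j=0}^{W}$ be the AR(2) matrix with parameters $\phi_1,\phi_2$ (defined in the context). There exist integers $A\ge 2$, $B\ge 2$, a symmetric 5-diagonal real matrix $\mathbf{A}=(a_{i,j})_{i,j=0}^{A}$ and a diagonal real matrix $\mathbf{B}=(b_{i,j})_{i,j=0}^{B}$ such that $\mathbf{W}=\mathbf{A}\ast\mathbf{B}$ if and only if either (a) $\phi_2=-1$, or (b) $\phi_1=0$ and $\phi_2=1$.
   Context: AR(2) matrix: for $W\ge 3$, $\mathbf{W}=(w_{i,j})_{i,j=0}^{W}$ is the symmetric 5-diagonal matrix ($w_{i,j}=0$ for $|i-j|>2$) such that - $w_{i,i+2}=-\phi_2$ for $0\le i\le W-2$; - $w_{0,1}=w_{W-1,W}=-\phi_1$ and $w_{i,i+1}=-\phi_1+\phi_1\phi_2$ for $1\le i\le W-2$; - $w_{0,0}=w_{W,W}=1$, $w_{1,1}=w_{W-1,W-1}=1+\phi_1^2$, and $w_{i,i}=1+\phi_1^2+\phi_2^2$ for $2\le i\le W-2$. A matrix is 5-diagonal if its $(i,j)$ entries vanish for $|i-j|>2$. Matrix convolution: for $\mathbf{A}=(a_{i,j})_{i,j=0}^{A}$ and $\mathbf{B}=(b_{i,j})_{i,j=0}^{B}$ the matrix $\mathbf{C}=\mathbf{A}\ast\mathbf{B}=(c_{i,j})_{i,j=0}^{A+B}$ has entries $c_{i,j}=\sum_{k,l}a_{k,l}\,b_{i-k,j-l}$,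 the sum being over all $k,l$ with $\max\{0,i-B\}\le k\le\min\{A,i\}$, $\max\{0,j-B\}\le l\le\min\{A,j\}$. In particular $\mathbf{W}=\mathbf{A}\ast\mathbf{B}$ requires $W=A+B$. *)

theory Defs
  imports Complex_Main "Jordan_Normal_Form.Matrix"
begin

definition five_diagonal_mat :: "'a::zero mat \<Rightarrow> bool" where
  "five_diagonal_mat M \<longleftrightarrow>
     (\<forall>i<dim_row M. \<forall>j<dim_col M. \<bar>int i - int j\<bar> > 2 \<longrightarrow> M $$ (i,j) = 0)"

(* A matrix indexed by {0..m} x {0..m} has dimension m + 1, so the largest index is the dimension
   minus 1. The truncated subtraction on nat in the lower summation bounds gives max 0 (i - n)
   and max 0 (j - n'). The definition is meant for matrices of positive dimensions. *)
definition conv_mat :: "'a::semiring_0 mat \<Rightarrow> 'a mat \<Rightarrow> 'a mat" where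
  "conv_mat A B =
     (let m = dim_row A - 1; m' = dim_col A - 1; n = dim_row B - 1; n' = dim_col B - 1
      in mat (m + n + 1) (m' + n' + 1) (\<lambda>(i,j).
           \<Sum>k\<in>{i - n..min m i}. \<Sum>l\<in>{j - n'..min m' j}. A $$ (k,l) * B $$ (i - k, j - l)))"

(* Meant for N >= 3: then the boundary cases below do not overlap, and on the first
   off-diagonals min i j ranges over {0..N - 1}. *)
definition ar2_mat :: "nat \<Rightarrow> real \<Rightarrow> real \<Rightarrow> real mat" where
  "ar2_mat N \<phi>\<^sub>1 \<phi>\<^sub>2 = mat (N + 1) (N + 1) (\<lambda>(i,j).
     if i = j then
       (if i = 0 \<or> i = N then 1
        else if i = 1 \<or> i = N - 1 then 1 + \<phi>\<^sub>1\<^sup>2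
        else 1 + \<phi>\<^sub>1\<^sup>2 + \<phi>\<^sub>2\<^sup>2)
     else if \<bar>int i - int j\<bar> = 1 then
       (if min i j = 0 \<or> min i j = N - 1 then - \<phi>\<^sub>1 else - \<phi>\<^sub>1 + \<phi>\<^sub>1 * \<phi>\<^sub>2)
     else if \<bar>int i - int j\<bar> = 2 then - \<phi>\<^sub>2
     else 0)"

end

theory Submission
  imports Defs "HOL-Computational_Algebra.Polynomial"
begin

text \<open>
  Encode the \<open>d\<close>-th superdiagonal of a square matrix as a polynomial. Convolution with a diagonal
  matrix multiplies all these polynomials by the polynomial \<open>b\<close> of its diagonal. For the AR(2) matrix
  the second superdiagonal is \<open>-\<phi>\<^sub>2 S\<close> with \<open>S = 1 + x + \<dots> + x\<^bsup>N-2\<^esup>\<close>, so \<open>b\<close> divides \<open>S\<close> and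
  \<open>x\<^bsup>N-1\<^esup> = 1\<close> modulo \<open>b\<close>. Modulo \<open>b\<close> the other two superdiagonals then reduce to
  \<open>-\<phi>\<^sub>1 (1 + \<phi>\<^sub>2)\<close> and \<open>(1 - \<phi>\<^sub>2\<^sup>2) (1 + x)\<close>, which must vanish since \<open>b\<close> has degree at least 2.
  Conversely one takes \<open>b = S\<close>, with the cofactor read off from the same identities.
\<close>

section \<open>Superdiagonal polynomials under convolution\<close>

definition diag_poly :: "'a::comm_monoid_add mat \<Rightarrow> nat \<Rightarrow> 'a poly" where
  "diag_poly M d = (\<Sum>k<dim_row M - d. monom (M $$ (k, k + d)) k)"

lemma coeff_diag_poly:
  "coeff (diag_poly M d) i = (if i + d < dim_row M then M $$ (i, i + d) else 0)"
  by (auto simp: diag_poly_def coeff_sum)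

text \<open>Diagonality of \<open>B\<close> leaves only the inner index \<open>l = k + d\<close>. As
  \<open>k\<close> lies between \<open>i - n\<close> and \<open>i\<close>, this index is in range
  exactly when \<open>k + d \<le> m\<close>.\<close>

lemma conv_mat_diagonal_entry:
  fixes A B :: "'a::comm_semiring_0 mat"
  assumes A: "A \<in> carrier_mat (m + 1) (m + 1)"
    and B: "B \<in> carrier_mat (n + 1) (n + 1)" "diagonal_mat B"
    and id: "i + d \<le> m + n"
  shows "conv_mat A B $$ (i, i + d) =
    (\<Sum>k\<in>{i - n..min m i}. if k + d \<le> m then A $$ (k, k + d) * B $$ (i - k, i - k) else 0)"
proof -
  have "(\<Sum>l\<in>{i + d - n..min m (i + d)}. A $$ (k, l) * B $$ (i - k, i + d - l))
      = (if k + d \<le> m then A $$ (k, k + d) * B $$ (i - k, i - k) else 0)"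
    if k: "k \<in> {i - n..min m i}" for k
  proof -
    have "(\<Sum>l\<in>{i + d - n..min m (i + d)}. A $$ (k, l) * B $$ (i - k, i + d - l))
      = (\<Sum>l\<in>{i + d - n..min m (i + d)}. if l = k + d then A $$ (k, l) * B $$ (i - k, i + d - l) else 0)"
    proof (rule sum.cong, simp)
      fix l assume "l \<in> {i + d - n..min m (i + d)}"
      then show "A $$ (k, l) * B $$ (i - k, i + d - l)
        = (if l = k + d then A $$ (k, l) * B $$ (i - k, i + d - l) else 0)"
        using B k by (auto simp: diagonal_mat_def)
    qed
    then show ?thesis using k by (auto simp: sum.delta)
  qed
  then show ?thesis using A B id by (simp add: conv_mat_def)
qed

lemma diag_poly_conv_mat:
  fixes A B :: "'a::comm_semiring_0 mat"
  assumes A: "A \<in> carrier_mat (m + 1) (m + 1)"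
    and B: "B \<in> carrier_mat (n + 1) (n + 1)" "diagonal_mat B"
  shows "diag_poly (conv_mat A B) d = diag_poly A d * diag_poly B 0"
proof (rule poly_eqI)
  fix i
  have dim: "dim_row (conv_mat A B) = m + n + 1" using A B by (simp add: conv_mat_def)
  have rhs: "coeff (diag_poly A d * diag_poly B 0) i = (\<Sum>k\<le>i. if k + d \<le> m \<and> i - k \<le> n
      then A $$ (k, k + d) * B $$ (i - k, i - k) else 0)"
    using A B by (auto simp: coeff_mult coeff_diag_poly intro!: sum.cong)
  show "coeff (diag_poly (conv_mat A B) d) i = coeff (diag_poly A d * diag_poly B 0) i"
  proof (cases "i + d \<le> m + n")
    case True
    \<comment> \<open>The convolution window is the support of the Cauchy product, so it may be
      enlarged to all \<open>k \<le> i\<close> by zero terms.\<close>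
    have "(\<Sum>k\<in>{i - n..min m i}. if k + d \<le> m then A $$ (k, k + d) * B $$ (i - k, i - k) else 0)
      = (\<Sum>k\<le>i. if k + d \<le> m \<and> i - k \<le> n then A $$ (k, k + d) * B $$ (i - k, i - k) else 0)"
      by (rule sum.mono_neutral_cong_left) auto
    then show ?thesis
      using True conv_mat_diagonal_entry[OF A B True] by (simp add: rhs coeff_diag_poly dim)
  next
    case False
    then show ?thesis by (auto simp: rhs coeff_diag_poly dim intro!: sum.neutral)
  qed
qed

section \<open>Superdiagonals of the AR(2) matrix modulo \<open>geom_poly\<close>\<close>

definition geom_poly :: "nat \<Rightarrow> real poly" where
  "geom_poly n = (\<Sum>k<n. monom 1 k)"

lemma coeff_geom_poly: "coeff (geom_poly n) i = (if i < n then 1 else 0)"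
  by (auto simp: geom_poly_def coeff_sum)

lemma diag_poly_ar2_2:
  assumes "N \<ge> 4"
  shows "diag_poly (ar2_mat N \<phi>\<^sub>1 \<phi>\<^sub>2) 2 = smult (- \<phi>\<^sub>2) (geom_poly (N - 1))"
  using assms by (auto intro!: poly_eqI simp: coeff_diag_poly coeff_geom_poly ar2_mat_def)

text \<open>In the next two lemmas \<open>x S - S\<close> stands for \<open>x\<^bsup>N-1\<^esup> - 1\<close>.\<close>

lemma diag_poly_ar2_1:
  assumes "N \<ge> 4"
  defines "S \<equiv> geom_poly (N - 1)"
  shows "diag_poly (ar2_mat N \<phi>\<^sub>1 \<phi>\<^sub>2) 1 =
    smult (- \<phi>\<^sub>1) (smult (1 - \<phi>\<^sub>2) S + (pCons 0 S - S)) + [:- \<phi>\<^sub>1 * (1 + \<phi>\<^sub>2):]"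
proof (rule poly_eqI)
  fix i
  show "coeff (diag_poly (ar2_mat N \<phi>\<^sub>1 \<phi>\<^sub>2) 1) i = coeff (smult (- \<phi>\<^sub>1) (smult (1 - \<phi>\<^sub>2) S
    + (pCons 0 S - S)) + [:- \<phi>\<^sub>1 * (1 + \<phi>\<^sub>2):]) i"
    using assms
    by (cases i) (auto simp: coeff_diag_poly coeff_geom_poly ar2_mat_def algebra_simps)
qed

lemma diag_poly_ar2_0:
  assumes "N \<ge> 4"
  defines "S \<equiv> geom_poly (N - 1)"
  shows "diag_poly (ar2_mat N \<phi>\<^sub>1 \<phi>\<^sub>2) 0 =
    smult (1 + \<phi>\<^sub>1\<^sup>2 + \<phi>\<^sub>2\<^sup>2) S + (smult (1 + \<phi>\<^sub>1\<^sup>2) (pCons 0 S - S) + pCons 0 (pCons 0 S - S))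
      + [:1 - \<phi>\<^sub>2\<^sup>2, 1 - \<phi>\<^sub>2\<^sup>2:]" (is "_ = ?R")
proof (rule poly_eqI)
  fix i
  \<comment> \<open>The right-hand side shifts \<open>S\<close> by up to two places, so the two
    lowest coefficients are separate cases.\<close>
  consider "i = 0" | "i = 1" | k where "i = Suc (Suc k)" by (metis One_nat_def not0_implies_Suc)
  then show "coeff (diag_poly (ar2_mat N \<phi>\<^sub>1 \<phi>\<^sub>2) 0) i = coeff ?R i"
    using assms
    by cases (auto simp: coeff_diag_poly coeff_geom_poly ar2_mat_def algebra_simps)
qed

section \<open>Necessity by divisibility\<close>

lemma ar2_mat_conv_imp:
  fixes A B :: "real mat"
  assumes N: "N \<ge> 4" and \<phi>: "\<phi>\<^sub>2 \<noteq> 0" and n: "n \<ge> 2"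
    and A: "A \<in> carrier_mat (m + 1) (m + 1)"
    and B: "B \<in> carrier_mat (n + 1) (n + 1)" "diagonal_mat B"
    and eq: "ar2_mat N \<phi>\<^sub>1 \<phi>\<^sub>2 = conv_mat A B"
  shows "\<phi>\<^sub>2 = -1 \<or> (\<phi>\<^sub>1 = 0 \<and> \<phi>\<^sub>2 = 1)"
proof -
  define b where "b = diag_poly B 0"
  define S where "S = geom_poly (N - 1)"
  have W: "diag_poly (ar2_mat N \<phi>\<^sub>1 \<phi>\<^sub>2) d = diag_poly A d * b" for d
    unfolding eq b_def by (rule diag_poly_conv_mat[OF A B])
  have Nmn: "N = m + n"
    using arg_cong[OF eq, of dim_row] A B by (simp add: ar2_mat_def conv_mat_def)
  \<comment> \<open>The last diagonal entry of \<open>B\<close> is not known to be nonzero in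
    advance. The corner entry 1 gives the product degree at least \<open>m + n\<close>, while the
    factor from \<open>A\<close> has degree at most \<open>m\<close>; hence \<open>b\<close> has
    degree at least \<open>n\<close>.\<close>
  have "coeff (diag_poly (ar2_mat N \<phi>\<^sub>1 \<phi>\<^sub>2) 0) N = 1"
    by (simp add: coeff_diag_poly ar2_mat_def)
  then have "N \<le> degree (diag_poly A 0 * b)"
    unfolding W[symmetric] by (intro le_degree) auto
  also have "\<dots> \<le> degree (diag_poly A 0) + degree b" by (rule degree_mult_le)
  also have "degree (diag_poly A 0) \<le> m"
    using A by (intro degree_le) (auto simp: coeff_diag_poly)
  finally have deg: "degree b \<ge> 2" using Nmn n by simp
  have dvd: "b dvd diag_poly (ar2_mat N \<phi>\<^sub>1 \<phi>\<^sub>2) d" for d unfolding W by simp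
  have S: "b dvd S"
    using dvd[of 2] \<phi> unfolding diag_poly_ar2_2[OF N] S_def by (simp add: dvd_smult_iff)
  have xS: "b dvd pCons 0 S"
    using dvd_mult[OF S, of "[:0, 1:]"] by simp
  have xxS: "b dvd pCons 0 (pCons 0 S - S)"
    using dvd_mult[OF dvd_diff[OF xS S], of "[:0, 1:]"] by simp
  \<comment> \<open>The remainders of the superdiagonals 1 and 0 have degree at most 0 and 1, so
    divisibility by \<open>b\<close> makes them vanish.\<close>
  have small: "p = 0" if "b dvd p" "degree p < 2" for p
    using that deg dvd_imp_degree_le[of b p] by force
  have "b dvd [:- \<phi>\<^sub>1 * (1 + \<phi>\<^sub>2):]"
    using dvd[of 1] S xS unfolding diag_poly_ar2_1[OF N] S_def[symmetric]
    by (subst (asm) dvd_add_right_iff) (intro dvd_smult dvd_add dvd_diff, assumption+)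
  from small[OF this] have 1: "\<phi>\<^sub>1 = 0 \<or> \<phi>\<^sub>2 = -1" by auto
  have "b dvd [:1 - \<phi>\<^sub>2\<^sup>2, 1 - \<phi>\<^sub>2\<^sup>2:]"
    using dvd[of 0] S xS xxS unfolding diag_poly_ar2_0[OF N] S_def[symmetric]
    by (subst (asm) dvd_add_right_iff) (intro dvd_smult dvd_add dvd_diff, assumption+)
  from small[OF this] have "\<phi>\<^sub>2\<^sup>2 = 1" by (auto split: if_splits)
  then show ?thesis using 1 by (auto simp: power2_eq_1_iff)
qed

section \<open>Sufficiency by an explicit factorization\<close>

text \<open>In cases (a) and (b) this is the rank-one matrix \<open>v v^T\<close> with
  \<open>v = (1, -\<phi>\<^sub>1, -\<phi>\<^sub>2)\<close>, since then
  \<open>\<phi>\<^sub>1 * \<phi>\<^sub>2 = -\<phi>\<^sub>1\<close> and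
  \<open>\<phi>\<^sub>2\<^sup>2 = 1\<close>.\<close>

definition ar2_kernel :: "real \<Rightarrow> real \<Rightarrow> real mat" where
  "ar2_kernel \<phi>\<^sub>1 \<phi>\<^sub>2 = mat 3 3 (\<lambda>(i,j).
     if i = j then (if i = 1 then \<phi>\<^sub>1\<^sup>2 else 1) else if i = 1 \<or> j = 1 then - \<phi>\<^sub>1 else - \<phi>\<^sub>2)"

text \<open>Convolution with the identity adds copies of the kernel shifted along the diagonal. In
  the interior this gives \<open>2 + \<phi>\<^sub>1\<^sup>2\<close>,
  \<open>-2 * \<phi>\<^sub>1\<close> and \<open>-\<phi>\<^sub>2\<close>, which are the AR(2) entries
  in cases (a) and (b).\<close>

lemma ar2_mat_conv_kernel_upper:
  assumes N: "N \<ge> 4" and \<phi>: "\<phi>\<^sub>2 = -1 \<or> (\<phi>\<^sub>1 = 0 \<and> \<phi>\<^sub>2 = 1)" and id: "i + d \<le> N"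
  shows "conv_mat (ar2_kernel \<phi>\<^sub>1 \<phi>\<^sub>2) (1\<^sub>m (N - 1)) $$ (i, i + d) = ar2_mat N \<phi>\<^sub>1 \<phi>\<^sub>2 $$ (i, i + d)"
proof -
  let ?K = "ar2_kernel \<phi>\<^sub>1 \<phi>\<^sub>2"
  have "conv_mat ?K (1\<^sub>m (N - 1)) $$ (i, i + d) = (\<Sum>k\<in>{i - (N - 2)..min 2 i}.
      if k + d \<le> 2 then ?K $$ (k, k + d) * 1\<^sub>m (N - 1) $$ (i - k, i - k) else 0)"
    by (rule conv_mat_diagonal_entry)
      (use N id in \<open>auto simp: ar2_kernel_def diagonal_mat_def\<close>)
  also have "\<dots> = (\<Sum>k\<in>{i - (N - 2)..min 2 i}. if k + d \<le> 2 then ?K $$ (k, k + d) else 0)"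
    by (rule sum.cong) (use N in auto)
  also have "\<dots> = ar2_mat N \<phi>\<^sub>1 \<phi>\<^sub>2 $$ (i, i + d)"
  proof -
    obtain M where M: "N = M + 4" using N by (metis le_add_diff_inverse2)
    define I where "I = {i - (N - 2)..min 2 i}"
    \<comment> \<open>Up to three shifted copies overlap at row \<open>i\<close>; the window is cut
      off only in the first two and last two rows.\<close>
    have I: "i = 0 \<Longrightarrow> I = {0}" "i = 1 \<Longrightarrow> I = {0, 1}"
      "2 \<le> i \<Longrightarrow> i \<le> M + 2 \<Longrightarrow> I = {0, 1, 2}"
      "i = M + 3 \<Longrightarrow> I = {1, 2}" "i = M + 4 \<Longrightarrow> I = {2}"
      unfolding I_def M by force+
    consider "i = 0" | "i = 1" | "2 \<le> i" "i \<le> M + 2" | "i = M + 3" | "i = M + 4"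
      using id M by linarith
    moreover have "d = 0 \<or> d = 1 \<or> d = 2 \<or> d > 2" by linarith
    ultimately show ?thesis
      unfolding I_def[symmetric]
      by cases (use id \<phi> in \<open>auto simp: I M ar2_mat_def ar2_kernel_def\<close>)
  qed
  finally show ?thesis .
qed

lemma dim_conv_mat:
  "dim_row (conv_mat A B) = dim_row A - 1 + (dim_row B - 1) + 1"
  "dim_col (conv_mat A B) = dim_col A - 1 + (dim_col B - 1) + 1"
  unfolding conv_mat_def Let_def by (rule dim_row_mat dim_col_mat)+

lemma index_conv_mat:
  assumes "i < dim_row (conv_mat A B)" "j < dim_col (conv_mat A B)"
  shows "conv_mat A B $$ (i, j) =
    (\<Sum>k\<in>{i - (dim_row B - 1)..min (dim_row A - 1) i}.
      \<Sum>l\<in>{j - (dim_col B - 1)..min (dim_col A - 1) j}. A $$ (k, l) * B $$ (i - k, j - l))"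
  using assms unfolding dim_conv_mat by (simp only: conv_mat_def Let_def index_mat(1) prod.case)

text \<open>Exchanging the two sums proves this. It makes a convolution of symmetric matrices
  symmetric.\<close>

lemma transpose_conv_mat:
  assumes "dim_row A > 0" "dim_col A > 0" "dim_row B > 0" "dim_col B > 0"
  shows "transpose_mat (conv_mat A B) = conv_mat (transpose_mat A) (transpose_mat B)"
proof (rule eq_matI)
  fix i j
  assume ij: "i < dim_row (conv_mat (transpose_mat A) (transpose_mat B))"
    "j < dim_col (conv_mat (transpose_mat A) (transpose_mat B))"
  then have ji: "j < dim_row (conv_mat A B)" "i < dim_col (conv_mat A B)"
    by (simp_all only: dim_conv_mat index_transpose_mat)
  have "(\<Sum>k\<in>{j - (dim_row B - 1)..min (dim_row A - 1) j}.
      \<Sum>l\<in>{i - (dim_col B - 1)..min (dim_col A - 1) i}. A $$ (k, l) * B $$ (j - k, i - l)) =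
    (\<Sum>l\<in>{i - (dim_col B - 1)..min (dim_col A - 1) i}.
      \<Sum>k\<in>{j - (dim_row B - 1)..min (dim_row A - 1) j}. A $$ (k, l) * B $$ (j - k, i - l))"
    by (rule sum.swap)
  also have "\<dots> = (\<Sum>l\<in>{i - (dim_col B - 1)..min (dim_col A - 1) i}.
      \<Sum>k\<in>{j - (dim_row B - 1)..min (dim_row A - 1) j}.
        transpose_mat A $$ (l, k) * transpose_mat B $$ (i - l, j - k))"
  proof (intro sum.cong refl)
    fix k l
    assume k: "k \<in> {j - (dim_row B - 1)..min (dim_row A - 1) j}"
      and l: "l \<in> {i - (dim_col B - 1)..min (dim_col A - 1) i}"
    \<comment> \<open>Positive dimensions matter here: for dimension 0 the truncated bound
      \<open>dim - 1\<close> would still admit the invalid index 0.\<close>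
    from k assms have "k < dim_row A" "j - k < dim_row B" by auto
    moreover from l assms have "l < dim_col A" "i - l < dim_col B" by auto
    ultimately show "A $$ (k, l) * B $$ (j - k, i - l) =
        transpose_mat A $$ (l, k) * transpose_mat B $$ (i - l, j - k)" by simp
  qed
  finally show "transpose_mat (conv_mat A B) $$ (i, j) =
      conv_mat (transpose_mat A) (transpose_mat B) $$ (i, j)"
    by (simp only: index_transpose_mat index_conv_mat[OF ij] index_conv_mat[OF ji] ji)
qed (simp_all only: dim_conv_mat index_transpose_mat)

lemma transpose_ar2_mat: "transpose_mat (ar2_mat N \<phi>\<^sub>1 \<phi>\<^sub>2) = ar2_mat N \<phi>\<^sub>1 \<phi>\<^sub>2"
  by (rule eq_matI) (auto simp: ar2_mat_def min.commute abs_minus_commute)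

lemma transpose_ar2_kernel: "transpose_mat (ar2_kernel \<phi>\<^sub>1 \<phi>\<^sub>2) = ar2_kernel \<phi>\<^sub>1 \<phi>\<^sub>2"
  by (rule eq_matI) (auto simp: ar2_kernel_def)

text \<open>Both sides are symmetric, so the entries on and above the diagonal decide.\<close>

lemma ar2_mat_eq_conv_mat_kernel:
  assumes N: "N \<ge> 4" and \<phi>: "\<phi>\<^sub>2 = -1 \<or> (\<phi>\<^sub>1 = 0 \<and> \<phi>\<^sub>2 = 1)"
  shows "ar2_mat N \<phi>\<^sub>1 \<phi>\<^sub>2 = conv_mat (ar2_kernel \<phi>\<^sub>1 \<phi>\<^sub>2) (1\<^sub>m (N - 1))" (is "?W = ?C")
proof (rule eq_matI)
  have dim: "dim_row ?C = N + 1" "dim_col ?C = N + 1" "dim_row ?W = N + 1" "dim_col ?W = N + 1"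
    using N by (auto simp: ar2_mat_def conv_mat_def ar2_kernel_def)
  then show "dim_row ?W = dim_row ?C" "dim_col ?W = dim_col ?C" by simp_all
  fix i j
  assume ij: "i < dim_row ?C" "j < dim_col ?C"
  have upper: "?W $$ (i, j) = ?C $$ (i, j)" if "i \<le> j" "j \<le> N" for i j
    using ar2_mat_conv_kernel_upper[OF N \<phi>, of i "j - i"] that by simp
  have sym: "transpose_mat ?C = ?C"
    using N by (subst transpose_conv_mat) (simp_all add: transpose_ar2_kernel, simp_all add: ar2_kernel_def)
  show "?W $$ (i, j) = ?C $$ (i, j)"
  proof (cases "i \<le> j")
    case True
    then show ?thesis using upper ij dim by simp
  next
    case False
    then have "transpose_mat ?W $$ (i, j) = transpose_mat ?C $$ (i, j)"
      using upper[of j i] ij dim by simp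
    then show ?thesis unfolding transpose_ar2_mat sym .
  qed
qed

theorem theorem4:
  fixes N :: nat and \<phi>\<^sub>1 \<phi>\<^sub>2 :: real
  assumes "N \<ge> 4" and "\<phi>\<^sub>2 \<noteq> 0"
  shows "(\<exists>(m::nat) (n::nat) (A::real mat) (B::real mat).
            m \<ge> 2 \<and> n \<ge> 2 \<and>
            A \<in> carrier_mat (m + 1) (m + 1) \<and> transpose_mat A = A \<and> five_diagonal_mat A \<and>
            B \<in> carrier_mat (n + 1) (n + 1) \<and> diagonal_mat B \<and>
            ar2_mat N \<phi>\<^sub>1 \<phi>\<^sub>2 = conv_mat A B)
         \<longleftrightarrow> \<phi>\<^sub>2 = -1 \<or> (\<phi>\<^sub>1 = 0 \<and> \<phi>\<^sub>2 = 1)"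
proof
  assume "\<phi>\<^sub>2 = -1 \<or> (\<phi>\<^sub>1 = 0 \<and> \<phi>\<^sub>2 = 1)"
  then have "ar2_mat N \<phi>\<^sub>1 \<phi>\<^sub>2 = conv_mat (ar2_kernel \<phi>\<^sub>1 \<phi>\<^sub>2) (1\<^sub>m (N - 1))"
    by (rule ar2_mat_eq_conv_mat_kernel[OF assms(1)])
  moreover have "ar2_kernel \<phi>\<^sub>1 \<phi>\<^sub>2 \<in> carrier_mat (2 + 1) (2 + 1)"
    "five_diagonal_mat (ar2_kernel \<phi>\<^sub>1 \<phi>\<^sub>2)"
    by (auto simp: ar2_kernel_def five_diagonal_mat_def)
  moreover note transpose_ar2_kernel
  \<comment> \<open>The kernel has largest index 2, so \<open>n = N - 2\<close>, and
    \<open>N \<ge> 4\<close> gives \<open>n \<ge> 2\<close>. The diagonal polynomial of this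
    identity matrix is \<open>geom_poly (N - 1)\<close>.\<close>
  moreover have "1\<^sub>m (N - 1) \<in> carrier_mat (N - 2 + 1) (N - 2 + 1)" "diagonal_mat (1\<^sub>m (N - 1))"
    using assms(1) by (auto simp: diagonal_mat_def)
  moreover have "N - 2 \<ge> 2" using assms(1) by simp
  ultimately show "\<exists>(m::nat) (n::nat) (A::real mat) (B::real mat).
      m \<ge> 2 \<and> n \<ge> 2 \<and>
      A \<in> carrier_mat (m + 1) (m + 1) \<and> transpose_mat A = A \<and> five_diagonal_mat A \<and>
      B \<in> carrier_mat (n + 1) (n + 1) \<and> diagonal_mat B \<and>
      ar2_mat N \<phi>\<^sub>1 \<phi>\<^sub>2 = conv_mat A B"
    by (intro exI[of _ 2] exI[of _ "N - 2"] exI[of _ "ar2_kernel \<phi>\<^sub>1 \<phi>\<^sub>2"]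
        exI[of _ "1\<^sub>m (N - 1)"]) simp
qed (use ar2_mat_conv_imp[OF assms] in blast)

end
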